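(* Every $ss$-characterized precompact abelian group is hereditarily disconnected.
   Context: All topological groups are Hausdorff and abelian. A topological group $G$ is hereditarily disconnected if the connected component of its neutral element is trivial. A group topology on $G$ is precompact if it is Hausdorff and for every neighborhood $U$ of $0$ there is a finite $F\subseteq G$ with $F+U=G$. A sequence $\mathbf{u}=(u_n)$ in an abelian group $G$ is a $TB$-sequence if there is a precompact group topology on $G$ in which $u_n\to0$; then $\tau_{\mathbf{u}}$ denotes the finest precompact group topology on $G$ in which $u_n\to 0$. A precompact group $(G,\tau)$ is $ss$-characterized if there is a $TB$-sequence $\mathbf{u}$ in $G$ with $\tau=\tau_{\mathbf{u}}$. *)

theory Defs
  imports "HOL-Analysis.Analysis" "HOL-Library.Set_Algebras"
begin

definition group_topology :: "'a::ab_group_add topology \<Rightarrow> bool" where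
  "group_topology T \<longleftrightarrow>
     topspace T = UNIV \<and>
     continuous_map (prod_topology T T) T (\<lambda>(x, y). x + y) \<and>
     continuous_map T T uminus"

text \<open>Neighbourhoods are not required to be open; the sum \<open>F + U\<close> is the elementwise sum of
  \<^theory>\<open>HOL-Library.Set_Algebras\<close>.\<close>

definition precompact_group_topology :: "'a::ab_group_add topology \<Rightarrow> bool" where
  "precompact_group_topology T \<longleftrightarrow>
     group_topology T \<and> Hausdorff_space T \<and>
     (\<forall>U. (\<exists>V. openin T V \<and> 0 \<in> V \<and> V \<subseteq> U) \<longrightarrow> (\<exists>F. finite F \<and> F + U = UNIV))"

definition TB_sequence :: "(nat \<Rightarrow> 'a::ab_group_add) \<Rightarrow> bool" where
  "TB_sequence u \<longleftrightarrow> (\<exists>T. precompact_group_topology T \<and> limitin T u 0 sequentially)"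

text \<open>\<open>finest_precompact_topology u T\<close> expresses \<open>T = \<tau>\<^sub>u\<close>. It is a relation rather than a
  function of \<open>u\<close>, so it has no unspecified value when \<open>u\<close> is not a TB-sequence.\<close>

definition finest_precompact_topology ::
    "(nat \<Rightarrow> 'a::ab_group_add) \<Rightarrow> 'a topology \<Rightarrow> bool" where
  "finest_precompact_topology u T \<longleftrightarrow>
     precompact_group_topology T \<and> limitin T u 0 sequentially \<and>
     (\<forall>S. precompact_group_topology S \<and> limitin S u 0 sequentially \<longrightarrow>
        (\<forall>U. openin S U \<longrightarrow> openin T U))"

lemma finest_precompact_topology_unique:
  assumes "finest_precompact_topology u S" "finest_precompact_topology u T"
  shows "S = T"
  using assms unfolding finest_precompact_topology_def topology_eq by blast

definition ss_characterized :: "'a::ab_group_add topology \<Rightarrow> bool" where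
  "ss_characterized T \<longleftrightarrow> (\<exists>u. TB_sequence u \<and> finest_precompact_topology u T)"

definition hereditarily_disconnected :: "'a::ab_group_add topology \<Rightarrow> bool" where
  "hereditarily_disconnected T \<longleftrightarrow> connected_component_of_set T 0 = {0}"

end

theory Submission imports Defs begin

text \<open>Let \<open>T = \<tau>\<^sub>u\<close>, let \<open>C\<close> be the connected component of \<open>0\<close>, and let \<open>D\<close> be a countable subgroup
  that contains every \<open>u n\<close>. The idea is that a character that kills \<open>D\<close> sends the sequence to \<open>1\<close>
  identically, so it can be made continuous without disturbing the convergence \<open>u\<^sub>n \<rightarrow> 0\<close>; since
  \<open>T\<close> is the finest candidate, it was continuous already. Precisely, the join of \<open>T\<close> with the
  topology induced by such a character is again precompact, and \<open>u\<close> still converges to \<open>0\<close> in it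
  (\<open>finest_precompact_topology_character\<close>).

  If \<open>x \<notin> D\<close>, then there is a character that kills \<open>D\<close>, does not kill \<open>x\<close> and takes only roots of
  unity as values (\<open>torsion_character_separates\<close>); this rests on the divisibility, hence injectivity,
  of the group of roots of unity, which is a copy of \<open>\<rat>/\<int>\<close>. As there are only countably many roots
  of unity, the image of \<open>C\<close> is a countable connected subset of the plane, that is, a point. So
  \<open>x \<notin> C\<close>, and altogether \<open>C \<subseteq> D\<close>.

  Thus \<open>C\<close> is countable. A topological group is regular, and a regular Hausdorff space that is
  connected and has more than one point is uncountable. Therefore \<open>C = {0}\<close>.\<close>

section \<open>Extending torsion characters of subgroups\<close>

primrec multiple :: "nat \<Rightarrow> 'a::ab_group_add \<Rightarrow> 'a" where
  "multiple 0 x = 0"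
| "multiple (Suc n) x = x + multiple n x"

lemma multiple_add: "multiple (m + n) x = multiple m x + multiple n x"
  by (induction m) (auto simp: add.assoc)

lemma multiple_mult: "multiple (m * n) x = multiple m (multiple n x)"
  by (induction m) (auto simp: multiple_add)

lemma multiple_diff: "n \<le> m \<Longrightarrow> multiple (m - n) x = multiple m x - multiple n x"
  using multiple_add[of "m - n" n x] by simp

text \<open>A homomorphism from a subgroup to the roots of unity, represented by its graph: a subgroup of
  \<open>G \<times> \<complex>\<^sup>\<times>\<close> that meets \<open>{0} \<times> \<complex>\<^sup>\<times>\<close> only in the neutral element. In this form
  extension is inclusion, and the union of a chain of extensions is literally a union of sets.\<close>

definition partial_character :: "('a::ab_group_add \<times> complex) set \<Rightarrow> bool" where
  "partial_character R \<longleftrightarrow>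
     (0, 1) \<in> R \<and>
     (\<forall>x z y w. (x, z) \<in> R \<longrightarrow> (y, w) \<in> R \<longrightarrow> (x - y, z / w) \<in> R) \<and>
     (\<forall>z. (0, z) \<in> R \<longrightarrow> z = 1) \<and>
     (\<forall>x z. (x, z) \<in> R \<longrightarrow> (\<exists>n>0. z ^ n = 1))"

lemma partial_characterD:
  assumes "partial_character R"
  shows partial_character_zero: "(0, 1) \<in> R"
    and partial_character_diff: "\<And>x z y w. (x, z) \<in> R \<Longrightarrow> (y, w) \<in> R \<Longrightarrow> (x - y, z / w) \<in> R"
    and partial_character_at_zero: "\<And>z. (0, z) \<in> R \<Longrightarrow> z = 1"
    and partial_character_torsion: "\<And>x z. (x, z) \<in> R \<Longrightarrow> \<exists>n>0. z ^ n = 1"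
  using assms unfolding partial_character_def by blast+

lemma partial_character_nonzero:
  assumes "partial_character R" "(x, z) \<in> R"
  shows "z \<noteq> 0"
  using partial_character_torsion[OF assms] by (auto simp: power_0_left split: if_splits)

lemma partial_character_uminus:
  assumes "partial_character R" "(x, z) \<in> R"
  shows "(- x, 1 / z) \<in> R"
  using partial_character_diff[OF assms(1) partial_character_zero[OF assms(1)] assms(2)] by simp

lemma partial_character_add:
  assumes "partial_character R" "(x, z) \<in> R" "(y, w) \<in> R"
  shows "(x + y, z * w) \<in> R"
  using partial_character_diff[OF assms(1,2) partial_character_uminus[OF assms(1,3)]] by simp

lemma partial_character_multiple:
  assumes "partial_character R" "(x, z) \<in> R"
  shows "(multiple n x, z ^ n) \<in> R"
  by (induction n)
     (auto simp: partial_character_zero[OF assms(1)] partial_character_add[OF assms])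

lemma partial_character_functional:
  assumes "partial_character R" "(x, z) \<in> R" "(x, w) \<in> R"
  shows "z = w"
  using partial_character_at_zero[OF assms(1), of "z / w"] partial_character_diff[OF assms]
    partial_character_nonzero[OF assms(1,3)] by simp

lemma root_of_unity_mult:
  fixes z w :: complex
  assumes "\<exists>n>0. z ^ n = 1" "\<exists>n>0. w ^ n = 1"
  shows "\<exists>n>0. (z * w) ^ n = 1"
proof -
  obtain m n where "m > 0" "z ^ m = 1" "n > 0" "w ^ n = 1"
    using assms by blast
  have "(z * w) ^ (m * n) = (z ^ m) ^ n * (w ^ n) ^ m"
    by (metis power_mult_distrib power_mult mult.commute)
  then have "(z * w) ^ (m * n) = 1 \<and> m * n > 0"
    using \<open>z ^ m = 1\<close> \<open>w ^ n = 1\<close> \<open>m > 0\<close> \<open>n > 0\<close> by simp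
  then show ?thesis by blast
qed

lemma root_of_unity_power:
  fixes z :: complex
  assumes "\<exists>n>0. z ^ n = 1"
  shows "\<exists>n>0. (z ^ m) ^ n = 1"
  using assms by (metis power_commutes power_mult mult.commute power_one)

lemma root_of_unity_inverse:
  fixes z :: complex
  assumes "\<exists>n>0. z ^ n = 1"
  shows "\<exists>n>0. (inverse z) ^ n = 1"
  using assms by (metis power_inverse inverse_1)

text \<open>One-step extension to the subgroup generated by the domain and \<open>y\<close>, with prescribed value \<open>z\<close> at
  \<open>y\<close>. Two descriptions \<open>a + k y\<close> of the same element differ by a multiple of \<open>y\<close> that lies in the
  old domain, so agreement there is exactly what makes the new value well defined. Integer
  multiples of \<open>y\<close> are written as differences of natural multiples.\<close>

lemma partial_character_adjoin:
  assumes R: "partial_character R" and z: "\<exists>n>0. z ^ n = 1"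
    and compatible: "\<And>k w. (multiple k y, w) \<in> R \<Longrightarrow> w = z ^ k"
  shows "\<exists>R'. partial_character R' \<and> R \<subseteq> R' \<and> (y, z) \<in> R'"
proof -
  define R' where "R' = {(a + multiple m y - multiple n y, w * z ^ m / z ^ n) | a w m n. (a, w) \<in> R}"
  have z0: "z \<noteq> 0"
    using z by (auto simp: power_0_left split: if_splits)
  have mem: "(a + multiple m y - multiple n y, w * z ^ m / z ^ n) \<in> R'" if "(a, w) \<in> R" for a w m n
    using that unfolding R'_def by blast
  have "R \<subseteq> R'"
  proof
    fix p assume "p \<in> R"
    then show "p \<in> R'" using mem[of "fst p" "snd p" 0 0] by simp
  qed
  moreover have "(y, z) \<in> R'"
    using mem[OF partial_character_zero[OF R], of 1 0] by simp
  moreover have "partial_character R'"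
    unfolding partial_character_def
  proof (intro conjI allI impI)
    show "(0, 1) \<in> R'"
      using mem[OF partial_character_zero[OF R], of 0 0] by simp
  next
    fix x s x' t assume "(x, s) \<in> R'" "(x', t) \<in> R'"
    then obtain a w m n b v k l where
      *: "(a, w) \<in> R" "x = a + multiple m y - multiple n y" "s = w * z ^ m / z ^ n"
      "(b, v) \<in> R" "x' = b + multiple k y - multiple l y" "t = v * z ^ k / z ^ l"
      unfolding R'_def by blast
    have "(a - b, w / v) \<in> R"
      using * partial_character_diff[OF R] by blast
    from mem[OF this, of "m + l" "n + k"] show "(x - x', s / t) \<in> R'"
      using z0 partial_character_nonzero[OF R \<open>(b, v) \<in> R\<close>]
      by (simp add: * multiple_add power_add algebra_simps)
  next
    fix s assume "(0, s) \<in> R'"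
    then obtain a w m n where
      *: "(a, w) \<in> R" "a + multiple m y - multiple n y = 0" "s = w * z ^ m / z ^ n"
      unfolding R'_def by force
    show "s = 1"
    proof (cases "m \<le> n")
      case True
      have "a = multiple (n - m) y"
        using *(2) True by (simp add: multiple_diff algebra_simps eq_neg_iff_add_eq_0)
      then have "w = z ^ (n - m)" using compatible *(1) by blast
      then show ?thesis using * True z0 by (simp flip: power_add)
    next
      case False
      then have "- a = multiple (m - n) y"
        using *(2) by (simp add: multiple_diff algebra_simps neg_eq_iff_add_eq_0)
      then have "1 / w = z ^ (m - n)"
        using compatible partial_character_uminus[OF R *(1)] by metis
      then have "z ^ m = (1 / w) * z ^ n"
        using False by (simp flip: power_add)
      then show ?thesis using * z0 partial_character_nonzero[OF R *(1)] by simp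
    qed
  next
    fix x s assume "(x, s) \<in> R'"
    then obtain a w m n where *: "(a, w) \<in> R" "s = (w * z ^ m) * inverse (z ^ n)"
      unfolding R'_def by (auto simp: divide_inverse)
    show "\<exists>n>0. s ^ n = 1"
      unfolding * by (intro root_of_unity_mult root_of_unity_inverse root_of_unity_power z
            partial_character_torsion[OF R *(1)])
  qed
  ultimately show ?thesis by blast
qed

text \<open>The \<open>k\<close> for which \<open>k y\<close> lies in the domain are the multiples of the least positive one, by
  division with remainder. Compatibility at that single exponent therefore suffices.\<close>

lemma partial_character_compatible:
  assumes R: "partial_character R" and "n > 0" and v: "(multiple n y, v) \<in> R"
    and least: "\<And>k. 0 < k \<Longrightarrow> k < n \<Longrightarrow> multiple k y \<notin> Domain R"
    and "z ^ n = v" and kw: "(multiple k y, w) \<in> R"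
  shows "w = z ^ k"
proof -
  have qv: "(multiple (k div n * n) y, v ^ (k div n)) \<in> R"
    unfolding multiple_mult by (rule partial_character_multiple[OF R v])
  have "k mod n = k - k div n * n"
    by (rule modulo_nat_def)
  then have "multiple (k mod n) y = multiple k y - multiple (k div n * n) y"
    by (simp add: multiple_diff)
  then have "multiple (k mod n) y \<in> Domain R"
    using partial_character_diff[OF R kw qv] by auto
  then have "k mod n = 0"
    using least[of "k mod n"] \<open>n > 0\<close> by auto
  then have k: "k div n * n = k" by auto
  have "w = v ^ (k div n)"
    using partial_character_functional[OF R kw] qv unfolding k by blast
  also have "\<dots> = z ^ (k div n * n)"
    by (simp add: \<open>z ^ n = v\<close>[symmetric] mult.commute flip: power_mult)
  finally show ?thesis unfolding k .
qed

text \<open>This is where divisibility enters: the constraint on the value at \<open>y\<close> is at most one equation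
  \<open>z ^ n = v\<close>, and an \<open>n\<close>-th root of a root of unity is a root of unity.\<close>

lemma partial_character_adjoin_any:
  assumes R: "partial_character R"
  shows "\<exists>R'. partial_character R' \<and> R \<subseteq> R' \<and> y \<in> Domain R'"
proof (cases "\<exists>n>0. multiple n y \<in> Domain R")
  case True
  define n where "n = (LEAST n. n > 0 \<and> multiple n y \<in> Domain R)"
  have n: "n > 0" "multiple n y \<in> Domain R"
    using LeastI_ex[OF True] unfolding n_def by auto
  have least: "multiple k y \<notin> Domain R" if "0 < k" "k < n" for k
    using not_less_Least[of k "\<lambda>n. n > 0 \<and> multiple n y \<in> Domain R"] that unfolding n_def by auto
  obtain v where v: "(multiple n y, v) \<in> R" using n by blast
  obtain z where z: "z ^ n = v"
    using exists_complex_root[of n v] n(1) by (metis less_not_refl)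
  obtain m where "m > 0" "v ^ m = 1" using partial_character_torsion[OF R v] by blast
  then have "\<exists>m>0. z ^ m = 1"
    using z n by (metis power_mult nat_0_less_mult_iff)
  then show ?thesis
    using partial_character_adjoin[OF R, of z y]
      partial_character_compatible[OF R n(1) v least z] by blast
next
  case False
  have "w = 1 ^ k" if "(multiple k y, w) \<in> R" for k w
  proof -
    have "k = 0" using False that by (metis DomainI gr0I)
    then show ?thesis using that partial_character_at_zero[OF R, of w] by simp
  qed
  moreover have "\<exists>n>0. (1::complex) ^ n = 1" by auto
  ultimately show ?thesis
    using partial_character_adjoin[OF R, of 1 y] by blast
qed

lemma partial_character_Union_chain:
  assumes "\<C> \<noteq> {}" and chain: "subset.chain {R. partial_character R} \<C>"
  shows "partial_character (\<Union>\<C>)"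
proof -
  have mem: "partial_character R" if "R \<in> \<C>" for R
    using chain that unfolding subset.chain_def by auto
  have two: "\<exists>R\<in>\<C>. p \<in> R \<and> q \<in> R" if "p \<in> \<Union>\<C>" "q \<in> \<Union>\<C>" for p q
    using chain that unfolding subset_chain_def by blast
  show ?thesis
    unfolding partial_character_def
  proof (intro conjI allI impI)
    show "(0, 1) \<in> \<Union>\<C>"
      using \<open>\<C> \<noteq> {}\<close> partial_character_zero[OF mem] by blast
  next
    fix x z y w assume "(x, z) \<in> \<Union>\<C>" "(y, w) \<in> \<Union>\<C>"
    then show "(x - y, z / w) \<in> \<Union>\<C>"
      using two partial_character_diff[OF mem] by (meson UnionI)
  qed (use partial_character_at_zero[OF mem] partial_character_torsion[OF mem] in blast)+
qed

text \<open>Injectivity of the group of roots of unity: a graph that is maximal by Zorn's lemma has full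
  domain, since otherwise another element could be adjoined.\<close>

lemma partial_character_extends:
  assumes R: "partial_character R"
  obtains \<psi> :: "'a::ab_group_add \<Rightarrow> complex"
  where "\<And>x y. \<psi> (x + y) = \<psi> x * \<psi> y" and "\<And>x. \<exists>n>0. \<psi> x ^ n = 1"
    and "\<And>x z. (x, z) \<in> R \<Longrightarrow> \<psi> x = z"
proof -
  define \<A> where "\<A> = {M. partial_character M \<and> R \<subseteq> M}"
  have "\<exists>M\<in>\<A>. \<forall>X\<in>\<A>. M \<subseteq> X \<longrightarrow> X = M"
  proof (rule subset_Zorn_nonempty)
    show "\<A> \<noteq> {}" using R unfolding \<A>_def by blast
    fix \<C> assume "\<C> \<noteq> {}" and ch: "subset.chain \<A> \<C>"
    have "subset.chain {R. partial_character R} \<C>"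
      using ch unfolding \<A>_def subset_chain_def by blast
    moreover have "R \<subseteq> \<Union>\<C>"
      using \<open>\<C> \<noteq> {}\<close> ch unfolding \<A>_def subset_chain_def by blast
    ultimately show "\<Union>\<C> \<in> \<A>"
      using partial_character_Union_chain[OF \<open>\<C> \<noteq> {}\<close>] unfolding \<A>_def by blast
  qed
  then obtain M where "M \<in> \<A>" and M_max: "\<forall>X\<in>\<A>. M \<subseteq> X \<longrightarrow> X = M"
    by (rule bexE)
  then have M: "partial_character M" "R \<subseteq> M"
    unfolding \<A>_def by auto
  have maximal: "X = M" if "partial_character X" "M \<subseteq> X" for X
    using M_max M(2) that unfolding \<A>_def by auto
  have "\<exists>z. (x, z) \<in> M" for x
    using partial_character_adjoin_any[OF M(1), of x] maximal by blast
  then obtain \<psi> where \<psi>: "\<And>x. (x, \<psi> x) \<in> M" by metis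
  show thesis
  proof
    show "\<psi> (x + y) = \<psi> x * \<psi> y" for x y
      using partial_character_functional[OF M(1) \<psi> partial_character_add[OF M(1) \<psi> \<psi>]] .
    show "\<exists>n>0. \<psi> x ^ n = 1" for x
      using partial_character_torsion[OF M(1) \<psi>] .
    show "\<psi> x = z" if "(x, z) \<in> R" for x z
      using partial_character_functional[OF M(1) \<psi>] that M(2) by blast
  qed
qed

text \<open>In the quotient by \<open>D\<close> the element \<open>x\<close> generates a nontrivial cyclic group, which has a
  nontrivial character: for finite order \<open>n\<close> it takes \<open>x\<close> to a primitive \<open>n\<close>-th root of unity, and
  for infinite order to \<open>-1\<close>. It extends to the whole group.\<close>

lemma torsion_character_separates:
  fixes D :: "'a::ab_group_add set"
  assumes "0 \<in> D" and D: "\<And>x y. x \<in> D \<Longrightarrow> y \<in> D \<Longrightarrow> x - y \<in> D" and "x \<notin> D"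
  obtains \<psi> :: "'a \<Rightarrow> complex"
  where "\<And>x y. \<psi> (x + y) = \<psi> x * \<psi> y" and "\<And>x. \<exists>n>0. \<psi> x ^ n = 1"
    and "\<And>d. d \<in> D \<Longrightarrow> \<psi> d = 1" and "\<psi> x \<noteq> 1"
proof -
  define R where "R = D \<times> {1::complex}"
  have R: "partial_character R"
    using assms unfolding partial_character_def R_def by auto
  have "\<exists>z. z \<noteq> 1 \<and> (\<exists>n>0. z ^ n = 1) \<and> (\<forall>k w. (multiple k x, w) \<in> R \<longrightarrow> w = z ^ k)"
  proof (cases "\<exists>n>0. multiple n x \<in> D")
    case True
    define n where "n = (LEAST n. n > 0 \<and> multiple n x \<in> D)"
    have n: "n > 0" "multiple n x \<in> D"
      using LeastI_ex[OF True] unfolding n_def by auto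
    have least: "multiple k x \<notin> Domain R" if "0 < k" "k < n" for k
      using not_less_Least[of k "\<lambda>n. n > 0 \<and> multiple n x \<in> D"] that
      unfolding n_def R_def by auto
    have "n \<noteq> 1" using n \<open>x \<notin> D\<close> by auto
    define z where "z = cis (2 * pi / n)"
    have "z ^ n = 1"
      using n by (simp add: z_def Complex.DeMoivre)
    moreover have "z \<noteq> 1"
    proof
      assume "z = 1"
      then have "cos (2 * pi / n) = 1" by (simp add: z_def complex_eq_iff)
      then obtain j :: int where "2 * pi / n = j * 2 * pi"
        by (auto simp: cos_one_2pi_int)
      then have "real_of_int (j * int n) = 1" using n by (simp add: field_simps)
      then have "j * int n = 1" by linarith
      then show False using n \<open>n \<noteq> 1\<close> by (auto simp: zmult_eq_1_iff)
    qed
    moreover have "(multiple n x, 1) \<in> R" using n by (simp add: R_def)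
    ultimately show ?thesis
      using partial_character_compatible[OF R n(1) _ least] n(1) by blast
  next
    case False
    have "w = (- 1) ^ k" if "(multiple k x, w) \<in> R" for k w
    proof -
      have "multiple k x \<in> D" "w = 1" using that by (auto simp: R_def)
      moreover from this(1) have "k = 0" using False by (metis gr0I)
      ultimately show ?thesis by simp
    qed
    moreover have "\<exists>n>0. (- 1 :: complex) ^ n = 1" by (intro exI[of _ 2]) auto
    ultimately show ?thesis by (intro exI[of _ "- 1"]) auto
  qed
  then obtain z where z: "z \<noteq> 1" "\<exists>n>0. z ^ n = 1"
    "\<And>k w. (multiple k x, w) \<in> R \<Longrightarrow> w = z ^ k" by blast
  from partial_character_adjoin[OF R z(2,3)] obtain R' where
    R': "partial_character R'" "R \<subseteq> R'" "(x, z) \<in> R'" by blast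
  obtain \<psi> where \<psi>: "\<And>x y. \<psi> (x + y) = \<psi> x * \<psi> y" "\<And>x. \<exists>n>0. \<psi> x ^ n = 1"
    "\<And>x z. (x, z) \<in> R' \<Longrightarrow> \<psi> x = z"
    using partial_character_extends[OF R'(1)] by blast
  show thesis
  proof (rule that[of \<psi>])
    show "\<psi> d = 1" if "d \<in> D" for d
      using \<psi>(3)[of d 1] R'(2) that unfolding R_def by blast
    show "\<psi> x \<noteq> 1"
      using \<psi>(3)[OF R'(3)] z(1) by simp
  qed (use \<psi> in auto)
qed

section \<open>Joining a group topology with a character\<close>

lemma group_topology_diff_nbhd:
  fixes T :: "'a::ab_group_add topology"
  assumes T: "group_topology T" and V: "openin T V" "0 \<in> V"
  obtains W where "openin T W" "0 \<in> W" "\<And>x y. x \<in> W \<Longrightarrow> y \<in> W \<Longrightarrow> x - y \<in> V"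
proof -
  have top: "topspace T = UNIV" using T by (simp add: group_topology_def)
  have "continuous_map (prod_topology T T) (prod_topology T T) (\<lambda>p. (fst p, - snd p))"
    using T unfolding group_topology_def
    by (intro continuous_map_pairedI continuous_map_fst
        continuous_map_compose[of _ T snd T uminus, unfolded o_def] continuous_map_snd) auto
  then have "continuous_map (prod_topology T T) T ((\<lambda>(x, y). x + y) \<circ> (\<lambda>p. (fst p, - snd p)))"
    using T unfolding group_topology_def by (intro continuous_map_compose) auto
  moreover define P where "P = {p. fst p - snd p \<in> V}"
  ultimately have "openin (prod_topology T T) P"
    using V(1) top unfolding continuous_map_def o_def by auto
  moreover have "(0, 0) \<in> P" using V by (simp add: P_def)
  ultimately obtain A B where "openin T A" "openin T B" "0 \<in> A" "0 \<in> B" "A \<times> B \<subseteq> P"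
    unfolding openin_prod_topology_alt by metis
  then show thesis
    by (intro that[of "A \<inter> B"]) (auto simp: P_def)
qed

lemma group_topology_translate:
  fixes T :: "'a::ab_group_add topology"
  assumes T: "group_topology T" and W: "openin T W"
  shows "openin T {x. x - a \<in> W}"
proof -
  have top: "topspace T = UNIV" using T by (simp add: group_topology_def)
  have "continuous_map T (prod_topology T T) (\<lambda>x. (x, - a))"
    using top by (intro continuous_map_pairedI) auto
  then have "continuous_map T T ((\<lambda>(x, y). x + y) \<circ> (\<lambda>x. (x, - a)))"
    using T unfolding group_topology_def by (intro continuous_map_compose) auto
  then show ?thesis
    using W top unfolding continuous_map_def o_def by auto
qed

text \<open>If \<open>W - W\<close> is contained in a neighbourhood of \<open>0\<close> whose translate by \<open>a\<close> misses \<open>C\<close>, then the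
  \<open>W\<close>-translates at \<open>a\<close> and at the points of \<open>C\<close> do not meet.\<close>

lemma group_topology_imp_regular_space:
  fixes T :: "'a::ab_group_add topology"
  assumes T: "group_topology T"
  shows "regular_space T"
  unfolding regular_space_def
proof (intro allI impI)
  fix C a assume "closedin T C \<and> a \<in> topspace T - C"
  moreover have "topspace T = UNIV" using T by (simp add: group_topology_def)
  ultimately have "openin T (- C)" "a \<notin> C"
    by (auto simp: closedin_def Compl_eq_Diff_UNIV)
  then have "openin T {x. x - (- a) \<in> - C}" "0 \<in> {x. x - (- a) \<in> - C}"
    using group_topology_translate[OF T, of "- C" "- a"] by auto
  then obtain W where W: "openin T W" "0 \<in> W"
    "\<And>x y. x \<in> W \<Longrightarrow> y \<in> W \<Longrightarrow> x - y \<in> {x. x - (- a) \<in> - C}"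
    using group_topology_diff_nbhd[OF T] by metis
  define U where "U = {x. x - a \<in> W}"
  define V where "V = (\<Union>c\<in>C. {x. x - c \<in> W})"
  have "openin T U" "openin T V"
    unfolding U_def V_def using group_topology_translate[OF T W(1)] by blast+
  moreover have "a \<in> U" "C \<subseteq> V"
    using W(2) by (auto simp: U_def V_def)
  moreover have "disjnt U V"
    unfolding disjnt_iff
  proof (intro allI notI, elim conjE)
    fix x assume "x \<in> U" "x \<in> V"
    then obtain c where "c \<in> C" "x - a \<in> W" "x - c \<in> W"
      by (auto simp: U_def V_def)
    then show False using W(3)[of "x - c" "x - a"] W(3)[of "x - a" "x - c"] by auto
  qed
  ultimately show "\<exists>U V. openin T U \<and> openin T V \<and> a \<in> U \<and> C \<subseteq> V \<and> disjnt U V" by blast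
qed

text \<open>The coarsest topology finer than \<open>T\<close> that makes \<open>\<psi>\<close> continuous: the group is identified with
  the graph of \<open>\<psi>\<close> inside \<open>T \<times> \<complex>\<close>.\<close>

definition character_join :: "'a topology \<Rightarrow> ('a \<Rightarrow> complex) \<Rightarrow> 'a topology" where
  "character_join T \<psi> = pullback_topology UNIV (\<lambda>x. (x, \<psi> x)) (prod_topology T euclidean)"

lemma topspace_character_join:
  "topspace T = UNIV \<Longrightarrow> topspace (character_join T \<psi>) = UNIV"
  by (auto simp: character_join_def topspace_pullback_topology)

lemma continuous_map_character_join:
  shows "continuous_map (character_join T \<psi>) T (\<lambda>x. x)"
    and "continuous_map (character_join T \<psi>) euclidean \<psi>"
  using continuous_map_pullback[OF continuous_map_fst, of UNIV "\<lambda>x. (x, \<psi> x)" T euclidean]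
    continuous_map_pullback[OF continuous_map_snd, of UNIV "\<lambda>x. (x, \<psi> x)" T euclidean]
  by (auto simp: character_join_def o_def)

lemma continuous_map_into_character_join:
  assumes "continuous_map X T f" "continuous_map X euclidean (\<lambda>x. \<psi> (f x))"
  shows "continuous_map X (character_join T \<psi>) f"
  unfolding character_join_def using assms
  by (intro continuous_map_pullback') (auto simp: o_def continuous_map_paired)

lemma character_join_nbhd:
  assumes "openin (character_join T \<psi>) U" "x \<in> U"
  obtains V e where "openin T V" "x \<in> V" "e > 0"
    "\<And>y. y \<in> V \<Longrightarrow> dist (\<psi> y) (\<psi> x) < e \<Longrightarrow> y \<in> U"
proof -
  obtain O' where O': "openin (prod_topology T euclidean) O'" "U = (\<lambda>x. (x, \<psi> x)) -` O'"
    using assms(1) by (auto simp: character_join_def openin_pullback_topology)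
  then have "(x, \<psi> x) \<in> O'" using assms(2) by auto
  with O'(1) obtain V B where VB: "openin T V" "open B" "x \<in> V" "\<psi> x \<in> B" "V \<times> B \<subseteq> O'"
    unfolding openin_prod_topology_alt by (metis open_openin)
  then obtain e where "e > 0" "\<And>w. dist w (\<psi> x) < e \<Longrightarrow> w \<in> B"
    by (auto simp: open_dist)
  then show thesis
    using VB O'(2) by (intro that[of V e]) auto
qed

text \<open>The group operations are continuous because they are so in both coordinates of the graph. For
  total boundedness, finitely many \<open>T\<close>-small translates and finitely many small arcs of the circle
  cut the group into finitely many cells. Two points of one cell differ by an element of the
  given neighbourhood, so one representative from each nonempty cell gives the finite set.\<close>

lemma precompact_character_join:
  fixes T :: "'a::ab_group_add topology" and \<psi> :: "'a \<Rightarrow> complex"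
  assumes T: "precompact_group_topology T"
    and hom: "\<And>x y. \<psi> (x + y) = \<psi> x * \<psi> y" and norm: "\<And>x. norm (\<psi> x) = 1"
  shows "precompact_group_topology (character_join T \<psi>)"
proof -
  let ?S = "character_join T \<psi>"
  have gT: "group_topology T" and hT: "Hausdorff_space T"
    and tb: "\<And>V. openin T V \<Longrightarrow> 0 \<in> V \<Longrightarrow> \<exists>F. finite F \<and> F + V = UNIV"
    using T unfolding precompact_group_topology_def by auto
  have topT: "topspace T = UNIV" using gT by (simp add: group_topology_def)
  have topS: "topspace ?S = UNIV" by (rule topspace_character_join[OF topT])
  have \<psi>nz: "\<psi> x \<noteq> 0" for x using norm[of x] by auto
  have \<psi>0: "\<psi> 0 = 1" using hom[of 0 0] \<psi>nz[of 0] by simp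
  have \<psi>_uminus: "\<psi> (- x) = cnj (\<psi> x)" for x
  proof -
    have "\<psi> (- x) * \<psi> x = cnj (\<psi> x) * \<psi> x"
      using hom[of "- x" x] complex_norm_square[of "\<psi> x"] norm[of x] \<psi>0 by (simp add: mult.commute)
    then show ?thesis using \<psi>nz[of x] by simp
  qed
  have \<psi>_diff: "dist (\<psi> (x - y)) 1 = dist (\<psi> x) (\<psi> y)" for x y
  proof -
    have "\<psi> x - \<psi> y = (\<psi> (x - y) - 1) * \<psi> y"
      using hom[of "x - y" y] by (simp add: algebra_simps)
    then show ?thesis by (simp add: dist_norm norm_mult norm)
  qed
  have fst': "continuous_map (prod_topology ?S ?S) ?S fst"
    and snd': "continuous_map (prod_topology ?S ?S) ?S snd"
    by (rule continuous_map_fst continuous_map_snd)+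
  note idS = continuous_map_character_join(1)[of T \<psi>]
  note \<psi>S = continuous_map_character_join(2)[of T \<psi>]
  have "continuous_map (prod_topology ?S ?S) ?S (\<lambda>(x, y). x + y)"
  proof (rule continuous_map_into_character_join)
    have "continuous_map (prod_topology ?S ?S) (prod_topology T T) (\<lambda>p. (fst p, snd p))"
      using continuous_map_compose[OF fst' idS] continuous_map_compose[OF snd' idS]
      by (intro continuous_map_pairedI) (auto simp: o_def)
    from continuous_map_compose[OF this, of T "\<lambda>(x, y). x + y"]
    show "continuous_map (prod_topology ?S ?S) T (\<lambda>(x, y). x + y)"
      using gT by (simp add: group_topology_def o_def case_prod_unfold)
    have "continuous_map (prod_topology ?S ?S) euclidean (\<lambda>p. (\<psi> (fst p), \<psi> (snd p)))"
      using continuous_map_compose[OF fst' \<psi>S] continuous_map_compose[OF snd' \<psi>S]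
      unfolding prod_topology_euclidean[symmetric]
      by (intro continuous_map_pairedI) (auto simp: o_def)
    moreover have "continuous_map euclidean euclidean (\<lambda>p::complex \<times> complex. fst p * snd p)"
      by (simp add: continuous_intros)
    ultimately have "continuous_map (prod_topology ?S ?S) euclidean
        ((\<lambda>p::complex \<times> complex. fst p * snd p) \<circ> (\<lambda>p. (\<psi> (fst p), \<psi> (snd p))))"
      by (rule continuous_map_compose)
    then show "continuous_map (prod_topology ?S ?S) euclidean (\<lambda>p. \<psi> (case p of (x, y) \<Rightarrow> x + y))"
      by (simp add: o_def case_prod_unfold hom)
  qed
  moreover have "continuous_map ?S ?S uminus"
  proof (rule continuous_map_into_character_join)
    show "continuous_map ?S T uminus"
      using continuous_map_compose[OF idS, of T uminus] gT by (simp add: group_topology_def o_def)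
    have "continuous_map euclidean euclidean cnj" by (simp add: continuous_intros)
    from continuous_map_compose[OF \<psi>S this]
    show "continuous_map ?S euclidean (\<lambda>x. \<psi> (- x))"
      by (simp add: o_def \<psi>_uminus)
  qed
  ultimately have "group_topology ?S"
    using topS by (simp add: group_topology_def)
  moreover have "Hausdorff_space ?S"
    by (rule Hausdorff_space_injective_preimage[OF hT idS]) (auto simp: inj_on_def)
  moreover have "\<exists>F. finite F \<and> F + U = UNIV" if O': "openin ?S O'" "0 \<in> O'" "O' \<subseteq> U" for U O'
  proof -
    obtain V e where V: "openin T V" "0 \<in> V" "e > 0"
      "\<And>y. y \<in> V \<Longrightarrow> dist (\<psi> y) 1 < e \<Longrightarrow> y \<in> U"
      using character_join_nbhd[OF O'(1,2)] O'(3) \<psi>0 by (metis subsetD)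
    obtain W where W: "openin T W" "0 \<in> W" "\<And>x y. x \<in> W \<Longrightarrow> y \<in> W \<Longrightarrow> x - y \<in> V"
      using group_topology_diff_nbhd[OF gT V(1,2)] by metis
    obtain F where F: "finite F" "F + W = UNIV" using tb[OF W(1,2)] by blast
    \<comment> \<open>Radius \<open>e / 2\<close>, so that two points of one arc are less than \<open>e\<close> apart.\<close>
    have "compact (sphere (0::complex) 1)" by simp
    then obtain A where A: "finite A" "sphere (0::complex) 1 \<subseteq> (\<Union>a\<in>A. ball a (e / 2))"
      using V(3) by (auto simp: compact_eq_totally_bounded dest: half_gt_zero)
    define cell where "cell = (\<lambda>(f, a). {x. x - f \<in> W \<and> \<psi> x \<in> ball a (e / 2)})"
    \<comment> \<open>Empty cells contribute arbitrary points, which do no harm.\<close>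
    define F' where "F' = (\<lambda>q. SOME x. x \<in> cell q) ` (F \<times> A)"
    have "x \<in> F' + U" for x
    proof -
      obtain f where f: "f \<in> F" "x - f \<in> W"
        using F(2) by (metis UNIV_I set_plus_elim add_diff_cancel_left')
      obtain a where a: "a \<in> A" "\<psi> x \<in> ball a (e / 2)"
        using A(2) norm[of x] by (auto simp: subset_iff)
      have x: "x \<in> cell (f, a)" using f a by (simp add: cell_def)
      define p where "p = (SOME x. x \<in> cell (f, a))"
      have p: "p \<in> cell (f, a)" unfolding p_def using x by (rule someI)
      have "x - p = (x - f) - (p - f)" by simp
      then have "x - p \<in> V" using W(3)[of "x - f" "p - f"] x p by (simp add: cell_def)
      moreover have "dist (\<psi> x) (\<psi> p) < e"
        using x p by (auto simp: cell_def intro: dist_triangle_half_r)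
      ultimately have "x - p \<in> U" using V(4) \<psi>_diff by metis
      moreover have "p \<in> F'" using f a unfolding F'_def p_def by blast
      ultimately show ?thesis using set_plus_intro[of p F' "x - p" U] by simp
    qed
    moreover have "finite F'" using F A by (simp add: F'_def)
    ultimately show ?thesis by blast
  qed
  ultimately show ?thesis
    unfolding precompact_group_topology_def by blast
qed

text \<open>The join with \<open>\<psi>\<close> competes in the definition of \<open>\<tau>\<^sub>u\<close>, because \<open>\<psi>\<close> is constant on the
  sequence; hence each of its open sets is open in \<open>T\<close>.\<close>

lemma finest_precompact_topology_character:
  fixes T :: "'a::ab_group_add topology" and \<psi> :: "'a \<Rightarrow> complex"
  assumes T: "finest_precompact_topology u T"
    and hom: "\<And>x y. \<psi> (x + y) = \<psi> x * \<psi> y" and norm: "\<And>x. norm (\<psi> x) = 1"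
    and one: "\<And>n. \<psi> (u n) = 1"
  shows "continuous_map T euclidean \<psi>"
proof -
  let ?S = "character_join T \<psi>"
  have pT: "precompact_group_topology T" and lim: "limitin T u 0 sequentially"
    and finest: "\<And>S U. precompact_group_topology S \<Longrightarrow> limitin S u 0 sequentially \<Longrightarrow>
      openin S U \<Longrightarrow> openin T U"
    using T unfolding finest_precompact_topology_def by auto
  have top: "topspace T = UNIV"
    using pT by (simp add: precompact_group_topology_def group_topology_def)
  have \<psi>0: "\<psi> 0 = 1" using hom[of 0 0] norm[of 0] by auto
  have "limitin ?S u 0 sequentially"
    unfolding limitin_def
  proof (intro conjI allI impI, goal_cases)
    case 1
    show ?case by (simp add: topspace_character_join[OF top])
  next
    case (2 U)
    then have U: "openin ?S U" "0 \<in> U" by auto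
    obtain V e where "openin T V" "0 \<in> V" "e > 0"
      "\<And>y. y \<in> V \<Longrightarrow> dist (\<psi> y) (\<psi> 0) < e \<Longrightarrow> y \<in> U"
      using character_join_nbhd[OF U] by metis
    moreover from this have "\<forall>\<^sub>F n in sequentially. u n \<in> V"
      using lim by (auto simp: limitin_def)
    ultimately show ?case by (auto elim: eventually_mono simp: one \<psi>0)
  qed
  then have "openin T U" if "openin ?S U" for U
    using finest[OF precompact_character_join[OF pT hom norm]] that by blast
  then show ?thesis
    using continuous_map_character_join(2)[of T \<psi>] top
    by (auto simp: continuous_map_def topspace_character_join[OF top])
qed

section \<open>The connected component of the neutral element\<close>

text \<open>The subgroup generated by the sequence consists of the values of finite words in the
  generators and their inverses, and there are only countably many words.\<close>

lemma countable_subgroup_containing_sequence: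
  fixes u :: "nat \<Rightarrow> 'a::ab_group_add"
  obtains D where "countable D" "range u \<subseteq> D" "0 \<in> D"
    "\<And>x y. x \<in> D \<Longrightarrow> y \<in> D \<Longrightarrow> x - y \<in> D"
proof -
  define val where "val = (\<lambda>l :: (nat \<times> bool) list.
    sum_list (map (\<lambda>(n, positive). if positive then u n else - u n) l))"
  have val_uminus: "- val l = val (map (\<lambda>(n, positive). (n, \<not> positive)) l)" for l
    by (induction l) (auto simp: val_def split: if_splits)
  have val_append: "val l + val m = val (l @ m)" for l m
    by (simp add: val_def)
  show thesis
  proof
    show "range u \<subseteq> range val"
    proof
      fix x assume "x \<in> range u"
      then obtain n where "x = u n" by blast
      then have "x = val [(n, True)]" by (simp add: val_def)
      then show "x \<in> range val" by blast
    qed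
    show "0 \<in> range val" by (rule range_eqI[of _ _ "[]"]) (simp add: val_def)
    show "x - y \<in> range val" if "x \<in> range val" "y \<in> range val" for x y
      using that by (auto simp: diff_conv_add_uminus val_uminus val_append simp del: add_uminus_conv_diff)
  qed simp
qed

lemma countable_roots_of_unity: "countable {z::complex. \<exists>n>0. z ^ n = 1}"
proof -
  have "{z::complex. \<exists>n>0. z ^ n = 1} = (\<Union>n\<in>{0<..}. {z. z ^ n = 1})" by auto
  moreover have "finite {z::complex. z ^ n = 1}" if "n \<in> {0<..}" for n
    using that by (intro finite_roots_unity) auto
  ultimately show ?thesis by (auto intro: countable_finite)
qed

text \<open>The image of \<open>C\<close> is connected and, consisting of roots of unity, countable; a connected metric
  space with two points is uncountable.\<close>

lemma torsion_character_trivial_on_component: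
  fixes T :: "'a::ab_group_add topology"
  assumes "continuous_map T euclidean \<psi>" and "\<And>x. \<exists>n>0. \<psi> x ^ n = (1::complex)"
    and "connectedin T C" "x \<in> C" "y \<in> C"
  shows "\<psi> x = \<psi> y"
proof (rule ccontr)
  assume "\<psi> x \<noteq> \<psi> y"
  have "connected (\<psi> ` C)"
    using connectedin_continuous_map_image[OF assms(1,3)] by simp
  then have "uncountable (\<psi> ` C)"
    using connected_uncountable \<open>\<psi> x \<noteq> \<psi> y\<close> assms(4,5) by blast
  moreover have "\<psi> ` C \<subseteq> {z. \<exists>n>0. z ^ n = 1}"
    using assms(2) by blast
  ultimately show False
    using countable_roots_of_unity countable_subset by blast
qed

lemma countable_connectedin_group_topology:
  fixes T :: "'a::ab_group_add topology"
  assumes T: "group_topology T" "Hausdorff_space T"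
    and C: "connectedin T C" "countable C"
  shows "\<exists>a. C \<subseteq> {a}"
proof -
  have "topspace (subtopology T C) = C" "connected_space (subtopology T C)"
    using C by (auto simp: connectedin_def)
  then show ?thesis
    using connected_space_imp_uncountable[of "subtopology T C"] C(2)
      regular_space_subtopology[OF group_topology_imp_regular_space[OF T(1)]]
      Hausdorff_space_subtopology[OF T(2)] by metis
qed

theorem corollary3p3:
  fixes T :: "'a::ab_group_add topology"
  assumes "precompact_group_topology T"
    and "ss_characterized T"
  shows "hereditarily_disconnected T"
proof -
  obtain u where u: "finest_precompact_topology u T"
    using assms(2) unfolding ss_characterized_def by blast
  have gT: "group_topology T" and hT: "Hausdorff_space T"
    using assms(1) by (auto simp: precompact_group_topology_def)
  obtain D where D: "countable D" "range u \<subseteq> D" "0 \<in> D"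
    "\<And>x y. x \<in> D \<Longrightarrow> y \<in> D \<Longrightarrow> x - y \<in> D"
    using countable_subgroup_containing_sequence by blast
  define C where "C = connected_component_of_set T 0"
  have C: "connectedin T C"
    unfolding C_def by (rule connectedin_connected_component_of)
  have "0 \<in> C"
    using gT by (simp add: C_def connected_component_of_refl group_topology_def)
  have "C \<subseteq> D"
  proof
    fix x assume "x \<in> C"
    show "x \<in> D"
    proof (rule ccontr)
      assume "x \<notin> D"
      then obtain \<psi> :: "'a \<Rightarrow> complex" where \<psi>: "\<And>x y. \<psi> (x + y) = \<psi> x * \<psi> y"
        "\<And>x. \<exists>n>0. \<psi> x ^ n = 1" "\<And>d. d \<in> D \<Longrightarrow> \<psi> d = 1" "\<psi> x \<noteq> 1"
        using torsion_character_separates[OF D(3,4)] by metis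
      have "norm (\<psi> y) = 1" for y
        using \<psi>(2)[of y] power_eq_1_iff[of "\<psi> y"] by auto
      then have "continuous_map T euclidean \<psi>"
        using finest_precompact_topology_character[OF u \<psi>(1)] \<psi>(3) D(2) by blast
      then have "\<psi> x = \<psi> 0"
        using torsion_character_trivial_on_component \<psi>(2) C \<open>x \<in> C\<close> \<open>0 \<in> C\<close> by blast
      then show False using \<psi>(3,4) D(3) by simp
    qed
  qed
  then have "countable C" using D(1) countable_subset by blast
  then have "C = {0}"
    using countable_connectedin_group_topology[OF gT hT C] \<open>0 \<in> C\<close> by blast
  then show ?thesis
    by (simp add: hereditarily_disconnected_def C_def)
qed

end
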